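(* Fix an integer $D\ge1$. Let $\chi$ be a real primitive Dirichlet character modulo $d$ such that $\chi(-1)\cdot d$ is a fundamental discriminant, let $a=(1-\chi(-1))/2$, and for real $t>0$ put $s=(1/2+it+a)/2$. Define \[ Z(t,\chi)=\sum_{n\ge1}\chi(n)\,n^{a}\,2\,\operatorname{Re}\bigl(G(s,\pi n^2/d)\bigr),\qquad G(s,x)=\int_1^\infty e^{-xy}y^{s}\,\frac{dy}{y}. \] Let $F_j$ denote the $j$-th Fibonacci number ($F_1=F_2=1$), $I_j=[F_j,F_{j+1})$, and for integers $j,k\ge0$ let \[ G_{j,k}(t)=\frac{2\,\operatorname{Re}\bigl(\tfrac{\partial^k G}{\partial x^k}(s,\pi F_j/d)\bigr)}{k!}. \] For positive integers $T,B$ set \[ S_{T,B}(t,\chi)=\sum_{j=1}^{T}\sum_{k=0}^{B}G_{j,k}(t)\,(\pi/d)^k\sum_{n\ge1,\;n^2\in I_j}\chi(n)\,n^{a}\,(n^2-F_j)^k . \] Then $Z(t,\chi)$ can be computed to $D$ digits of accuracy as $S_{T,B}(t,\chi)$ with $T$ and $B$ both $O(\log d)$: there is a constant $C_D$ depending only on $D$ such that for all sufficiently large $d$ there are positive integers $T,B\le C_D\log d$ with $|Z(t,\chi)-S_{T,B}(t,\chi)|<10^{-D}$ for every $t>0$.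
   Context: $Z(t,\chi)$ is the completed $L$-function $\xi(1/2+it,\chi)$ of $\chi$ written via this series (approximate functional equation); $\frac{\partial^k G}{\partial x^k}$ denotes the $k$-th derivative of $G$ in its second variable. "To $D$ digits of accuracy" means absolute error less than $10^{-D}$. *)

theory Defs
  imports
    "HOL-Analysis.Analysis"
    "HOL-Number_Theory.Fib"
    "HOL-Computational_Algebra.Squarefree"
begin

definition dirichlet_character :: "nat \<Rightarrow> (int \<Rightarrow> complex) \<Rightarrow> bool" where
  "dirichlet_character d chi \<longleftrightarrow>
     0 < d \<and>
     (\<forall>m n. chi (m * n) = chi m * chi n) \<and>
     (\<forall>n. chi (n + int d) = chi n) \<and>
     (\<forall>n. chi n \<noteq> 0 \<longleftrightarrow> coprime n (int d))"

definition primitive_character :: "nat \<Rightarrow> (int \<Rightarrow> complex) \<Rightarrow> bool" where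
  "primitive_character d chi \<longleftrightarrow>
     dirichlet_character d chi \<and>
     \<not> (\<exists>q \<psi>. q dvd d \<and> q < d \<and> dirichlet_character q \<psi> \<and>
            (\<forall>n. coprime n (int d) \<longrightarrow> chi n = \<psi> n))"

definition real_character :: "(int \<Rightarrow> complex) \<Rightarrow> bool" where
  "real_character chi \<longleftrightarrow> (\<forall>n. chi n \<in> \<real>)"

definition fundamental_discriminant :: "int \<Rightarrow> bool" where
  "fundamental_discriminant \<Delta> \<longleftrightarrow>
     (\<Delta> mod 4 = 1 \<and> squarefree \<Delta>) \<or>
     (\<exists>m. \<Delta> = 4 * m \<and> m mod 4 \<in> {2, 3} \<and> squarefree m)"

definition char_parity :: "(int \<Rightarrow> complex) \<Rightarrow> complex" where
  "char_parity chi = (1 - chi (-1)) / 2"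

definition s_param :: "(int \<Rightarrow> complex) \<Rightarrow> real \<Rightarrow> complex" where
  "s_param chi t = (1 / 2 + \<i> * of_real t + char_parity chi) / 2"

definition G :: "complex \<Rightarrow> real \<Rightarrow> complex" where
  "G s x = (LBINT y:{1..}. of_real (exp (- x * y)) * of_real y powr s / of_real y)"

text \<open>\<^const>\<open>deriv\<close> only applies to functions from a field to itself, so the \<open>k\<close>-th derivative
  of \<^term>\<open>G s :: real \<Rightarrow> complex\<close> is the \<open>k\<close>-fold iterate of \<^const>\<open>vector_derivative\<close>.\<close>

definition dG :: "nat \<Rightarrow> complex \<Rightarrow> real \<Rightarrow> complex" where
  "dG k s = ((\<lambda>f x. vector_derivative f (at x)) ^^ k) (G s)"

definition Z :: "nat \<Rightarrow> (int \<Rightarrow> complex) \<Rightarrow> real \<Rightarrow> complex" where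
  "Z d chi t =
     (\<Sum>\<^sub>\<infinity>n\<in>{1::nat..}. chi (int n) * of_nat n powr char_parity chi *
        of_real (2 * Re (G (s_param chi t) (pi * real (n ^ 2) / real d))))"

definition G_coeff :: "nat \<Rightarrow> (int \<Rightarrow> complex) \<Rightarrow> nat \<Rightarrow> nat \<Rightarrow> real \<Rightarrow> real" where
  "G_coeff d chi j k t =
     2 * Re (dG k (s_param chi t) (pi * real (fib j) / real d)) / fact k"

definition S :: "nat \<Rightarrow> nat \<Rightarrow> nat \<Rightarrow> (int \<Rightarrow> complex) \<Rightarrow> real \<Rightarrow> complex" where
  "S T B d chi t =
     (\<Sum>j=1..T. \<Sum>k=0..B. of_real (G_coeff d chi j k t * (pi / real d) ^ k) *
        (\<Sum>n | 1 \<le> n \<and> n ^ 2 \<in> {fib j..<fib (j + 1)}.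
           chi (int n) * of_nat n powr char_parity chi * (of_nat (n ^ 2) - of_nat (fib j)) ^ k))"

end

(* For n^2 in I_j the point pi n^2/d exceeds x = pi F_j/d by h with h/x <= 2/3, because
   F_{j-1} <= 2 F_j/3 for j >= 3 (for j = 2 only n = 1, with h = 0, occurs).  The exponential
   series of exp (-hy) alternates, so cutting the Taylor series of G(s, _) at x after the B-th
   term costs at most the integral of exp (-xy) (hy)^(B+1)/(B+1)! over y >= 0, which is
   (h/x)^(B+1)/x <= d (2/3)^(B+1), uniformly in t as |y^(s-1)| <= 1.  Since the Fibonacci numbers
   grow exponentially, some T = O(log d) puts all neglected n beyond d, where the terms are
   at most 2 exp (-n), while F_(T+1) stays polynomial in d; hence some B = O(log d) makes
   the total Taylor error O(1/d). *)
theory Submission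
  imports Defs "HOL-Probability.Distributions"
begin


section \<open>Integrals over [1, oo) and differentiation of G under the integral sign\<close>

lemma set_lebesgue_bound_power_exp:
  fixes f :: "real \<Rightarrow> complex" and K c :: real and m :: nat
  assumes c: "c > 0" and f: "continuous_on {1..} f"
    and bd: "\<And>y. y \<ge> 1 \<Longrightarrow> norm (f y) \<le> K * (y ^ m * exp (- c * y))"
  shows "set_integrable lborel {1..} f"
    and "norm (LBINT y:{1..}. f y) \<le> K * (fact m / c ^ Suc m)"
proof -
  \<comment> \<open>The Erlang density is c^(m+1) y^m exp (-cy) / m! on y >= 0, so \<open>g\<close>
    is the majorant K y^m exp (-cy) there, and total mass 1 yields its integral without any
    computation.\<close>
  define g where "g = (\<lambda>y. K * (fact m / c ^ Suc m) * erlang_density m c y)"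
  have "has_bochner_integral lborel (erlang_density m c) 1"
    using nn_integral_erlang_ith_moment[OF c, of m 0] c
    by (intro has_bochner_integral_nn_integral) auto
  hence g: "has_bochner_integral lborel g (K * (fact m / c ^ Suc m))"
    using has_bochner_integral_mult_right[of "K * (fact m / c ^ Suc m)" lborel "erlang_density m c" 1]
    unfolding g_def by simp
  have "0 \<le> K * (1 * exp (-c))" using order_trans[OF norm_ge_zero bd[of 1]] by simp
  hence K: "K \<ge> 0" by (simp add: zero_le_mult_iff)
  have geq: "g y = K * (y ^ m * exp (- c * y))" if "y \<ge> 0" for y
    using that c by (simp add: g_def erlang_density_def field_simps)
  have g0: "g y \<ge> 0" for y using K c by (simp add: g_def)
  have le: "norm (indicator {1..} y *\<^sub>R f y) \<le> g y" for y
    using bd[of y] geq[of y] g0[of y] by (auto simp: indicator_def)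
  have meas: "(\<lambda>y. indicator {1..} y *\<^sub>R f y) \<in> borel_measurable lborel"
    using borel_measurable_continuous_on_indicator[OF _ f] by simp
  have gi: "integrable lborel g" and gv: "integral\<^sup>L lborel g = K * (fact m / c ^ Suc m)"
    using g by (auto simp: has_bochner_integral_iff)
  have int: "integrable lborel (\<lambda>y. indicator {1..} y *\<^sub>R f y)"
    by (rule Bochner_Integration.integrable_bound[OF gi meas]) (use le g0 in \<open>auto intro!: AE_I2\<close>)
  show "set_integrable lborel {1..} f" using int by (simp add: set_integrable_def)
  have "norm (LBINT y:{1..}. f y) \<le> integral\<^sup>L lborel g"
    unfolding set_lebesgue_integral_def
    by (rule Bochner_Integration.integral_norm_bound_integral[OF int gi]) (use le in auto)
  thus "norm (LBINT y:{1..}. f y) \<le> K * (fact m / c ^ Suc m)" by (simp add: gv)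
qed

definition mellin_kernel :: "complex \<Rightarrow> real \<Rightarrow> complex" where
  "mellin_kernel s y = of_real y powr s / of_real y"

text \<open>The modulus y^(Re s - 1) does not see Im s. This is the source of the uniformity in t of
  all later bounds.\<close>

lemma norm_mellin_kernel_le:
  assumes "Re s \<le> 1" "y \<ge> 1" shows "norm (mellin_kernel s y) \<le> 1"
proof -
  have "y powr Re s \<le> y powr 1" using assms by (intro powr_mono) auto
  thus ?thesis using assms by (simp add: mellin_kernel_def norm_divide norm_powr_real_powr)
qed

lemma continuous_on_mellin_kernel [continuous_intros]: "continuous_on {1..} (mellin_kernel s)"
  unfolding mellin_kernel_def
  by (intro continuous_intros) (auto simp: complex_nonpos_Reals_iff)

text \<open>Every integrand below is a real factor \<open>r\<close> times the kernel, so each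
  complex estimate reduces to a real inequality for \<open>r\<close>.\<close>

lemma mellin_bound_power_exp:
  fixes r :: "real \<Rightarrow> real" and K c :: real and m :: nat
  assumes s: "Re s \<le> 1" and c: "c > 0" and r: "continuous_on {1..} r"
    and bd: "\<And>y. y \<ge> 1 \<Longrightarrow> \<bar>r y\<bar> \<le> K * (y ^ m * exp (- c * y))"
  shows "set_integrable lborel {1..} (\<lambda>y. of_real (r y) * mellin_kernel s y)"
    and "norm (LBINT y:{1..}. of_real (r y) * mellin_kernel s y) \<le> K * (fact m / c ^ Suc m)"
proof -
  have "continuous_on {1..} (\<lambda>y. of_real (r y) * mellin_kernel s y)"
    by (intro continuous_intros r)
  moreover have "norm (of_real (r y) * mellin_kernel s y) \<le> K * (y ^ m * exp (- c * y))"
    if "y \<ge> 1" for y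
    using mult_mono[OF bd[OF that] norm_mellin_kernel_le[OF s that]] order_trans[OF abs_ge_zero bd[OF that]]
    by (simp add: norm_mult)
  ultimately show "set_integrable lborel {1..} (\<lambda>y. of_real (r y) * mellin_kernel s y)"
    "norm (LBINT y:{1..}. of_real (r y) * mellin_kernel s y) \<le> K * (fact m / c ^ Suc m)"
    using set_lebesgue_bound_power_exp[OF c] by blast+
qed

text \<open>The candidate for the k-th x-derivative of G: each differentiation of exp (-xy) in x
  brings down a factor -y.\<close>

definition G_moment :: "nat \<Rightarrow> complex \<Rightarrow> real \<Rightarrow> complex" where
  "G_moment k s x = (LBINT y:{1..}. of_real ((- y) ^ k * exp (- x * y)) * mellin_kernel s y)"

lemma G_moment_0: "G_moment 0 s = G s"
  by (simp add: fun_eq_iff G_moment_def G_def mellin_kernel_def)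

lemma G_moment_integrable:
  assumes "Re s \<le> 1" "x > 0"
  shows "set_integrable lborel {1..} (\<lambda>y. of_real ((- y) ^ k * exp (- x * y)) * mellin_kernel s y)"
  by (rule mellin_bound_power_exp(1)[OF assms, where m = k and K = 1])
     (auto intro!: continuous_intros simp: abs_mult power_abs)

lemma abs_exp_minus_linear_le: "\<bar>exp u - 1 - u\<bar> \<le> u\<^sup>2 * exp \<bar>u\<bar>" for u :: real
proof -
  obtain t where t: "\<bar>t\<bar> \<le> \<bar>u\<bar>" "exp u = (\<Sum>m<2. u ^ m / fact m) + exp t / fact 2 * u ^ 2"
    using Maclaurin_exp_le by blast
  have "exp u - 1 - u = exp t / 2 * u\<^sup>2" using t(2) by (simp add: numeral_2_eq_2)
  moreover have "exp t / 2 \<le> exp \<bar>u\<bar>"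
    using t(1) by (smt (verit) exp_le_cancel_iff exp_ge_zero field_sum_of_halves)
  ultimately show ?thesis
    using mult_right_mono[of "exp t / 2" "exp \<bar>u\<bar>" "u\<^sup>2"] by (simp only: abs_mult mult.commute) simp
qed

text \<open>The error of the linear approximation is again an integral against the kernel, with the
  second-order remainder of exp (-hy) in it. Bounding it by a constant times h^2 replaces an appeal
  to dominated convergence.\<close>

lemma has_vector_derivative_G_moment:
  assumes s: "Re s \<le> 1" and x: "x > 0"
  shows "(G_moment k s has_vector_derivative G_moment (Suc k) s x) (at x)"
proof -
  \<comment> \<open>The square (hy)^2 raises the moment from k to k + 2, and |h| < x/2 lets exp |hy|
    consume only half of the decay exp (-xy).\<close>
  define M where "M = fact (k + 2) / (x / 2) ^ Suc (k + 2)"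
  have bound: "norm (G_moment k s z - G_moment k s x - (z - x) *\<^sub>R G_moment (Suc k) s x)
      \<le> (z - x)\<^sup>2 * M" if z: "\<bar>z - x\<bar> < x / 2" for z
  proof -
    define h where "h = z - x"
    have zpos: "z > 0" using z by (simp add: abs_if split: if_splits)
    define r where "r = (\<lambda>y. (- y) ^ k * exp (- x * y) * (exp (- h * y) - 1 - (- h * y)))"
    note i1 = G_moment_integrable[OF s zpos, of k] and i2 = G_moment_integrable[OF s x, of k]
    have i3: "set_integrable lborel {1..}
        (\<lambda>y. of_real h * (of_real ((- y) ^ Suc k * exp (- x * y)) * mellin_kernel s y))"
      using G_moment_integrable[OF s x, of "Suc k"] by (intro set_integrable_mult_right) blast
    have "G_moment k s z - G_moment k s x - h *\<^sub>R G_moment (Suc k) s x =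
        (LBINT y:{1..}. of_real ((- y) ^ k * exp (- z * y)) * mellin_kernel s y
          - of_real ((- y) ^ k * exp (- x * y)) * mellin_kernel s y
          - of_real h * (of_real ((- y) ^ Suc k * exp (- x * y)) * mellin_kernel s y))"
      by (simp only: G_moment_def scaleR_conv_of_real set_integral_mult_right
          set_integral_diff(2)[OF set_integral_diff(1)[OF i1 i2] i3] set_integral_diff(2)[OF i1 i2])
    also have "\<dots> = (LBINT y:{1..}. of_real (r y) * mellin_kernel s y)"
    proof (rule arg_cong[where f = "\<lambda>f. LBINT y:{1..}. f y"], rule ext)
      fix y
      have "exp (- z * y) = exp (- x * y) * exp (- h * y)"
        by (simp add: h_def exp_add[symmetric] algebra_simps)
      hence "(- y) ^ k * exp (- z * y) - (- y) ^ k * exp (- x * y)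
          - h * ((- y) ^ Suc k * exp (- x * y)) = r y"
        by (simp add: r_def algebra_simps)
      thus "of_real ((- y) ^ k * exp (- z * y)) * mellin_kernel s y
          - of_real ((- y) ^ k * exp (- x * y)) * mellin_kernel s y
          - of_real h * (of_real ((- y) ^ Suc k * exp (- x * y)) * mellin_kernel s y)
          = of_real (r y) * mellin_kernel s y"
        by (metis (no_types, lifting) mult.assoc left_diff_distrib of_real_diff of_real_mult)
    qed
    also have "norm \<dots> \<le> h\<^sup>2 * M"
      unfolding M_def
    proof (rule mellin_bound_power_exp(2)[OF s])
      show "continuous_on {1..} r" unfolding r_def by (intro continuous_intros)
      fix y :: real assume y: "y \<ge> 1"
      have "\<bar>h\<bar> * y \<le> x / 2 * y" using y z by (intro mult_right_mono) (auto simp: h_def)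
      hence e: "exp (- x * y) * exp \<bar>- h * y\<bar> \<le> exp (- (x / 2) * y)"
        using y by (simp add: exp_add[symmetric] abs_mult field_simps)
      have "\<bar>r y\<bar> \<le> y ^ k * exp (- x * y) * ((h * y)\<^sup>2 * exp \<bar>- h * y\<bar>)"
        using abs_exp_minus_linear_le[of "- h * y"] y
        by (auto simp: r_def abs_mult power_abs intro!: mult_left_mono)
      also have "\<dots> = y ^ k * (h * y)\<^sup>2 * (exp (- x * y) * exp \<bar>- h * y\<bar>)" by simp
      also have "\<dots> \<le> y ^ k * (h * y)\<^sup>2 * exp (- (x / 2) * y)"
        using e y by (intro mult_left_mono) auto
      also have "\<dots> = h\<^sup>2 * (y ^ (k + 2) * exp (- (x / 2) * y))"
        by (simp add: power_mult_distrib power_add power2_eq_square)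
      finally show "\<bar>r y\<bar> \<le> h\<^sup>2 * (y ^ (k + 2) * exp (- (x / 2) * y))" .
    qed (use x in auto)
    finally show ?thesis by (simp add: h_def)
  qed
  show ?thesis
    unfolding has_vector_derivative_def
  proof (rule has_derivativeI_sandwich[where e = "x / 2" and H = "\<lambda>z. norm (z - x) * M"])
    fix z assume "z \<noteq> x" "dist z x < x / 2"
    thus "norm (G_moment k s z - G_moment k s x - (z - x) *\<^sub>R G_moment (Suc k) s x) / norm (z - x)
        \<le> norm (z - x) * M"
      using bound[of z] by (simp add: dist_real_def divide_le_eq power2_eq_square mult_ac
          flip: abs_mult)
  next
    show "((\<lambda>z. norm (z - x) * M) \<longlongrightarrow> 0) (at x)"
      by (rule tendsto_eq_intros refl | simp)+
  qed (use x in \<open>auto intro: bounded_linear_scaleR_left\<close>)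
qed

text \<open>Only for \<open>x > 0\<close>: elsewhere the integral may diverge and \<^const>\<open>G\<close> is then \<open>0\<close>.\<close>

lemma dG_eq_G_moment:
  assumes s: "Re s \<le> 1" and x: "x > 0"
  shows "dG k s x = G_moment k s x"
  using x
proof (induction k arbitrary: x)
  case 0
  show ?case by (simp add: dG_def G_moment_0)
next
  case (Suc k)
  have "(dG k s has_vector_derivative G_moment (Suc k) s x) (at x)"
    \<comment> \<open>The induction hypothesis gives \<open>dG k s\<close> =
      \<open>G_moment k s\<close> only on the positive reals; that set is open, so the derivatives
      at x agree.\<close>
    using has_vector_derivative_transform_within_open[OF has_vector_derivative_G_moment[OF s Suc.prems, of k], of "{0<..}" "dG k s"]
      Suc by auto
  thus ?case using vector_derivative_at by (force simp: dG_def)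
qed

text \<open>For y >= 1 the exponent xy is at least x/2 + xy/2. One half leaves the integral as exp
  (-x/2), the other integrates to at most 2/x.\<close>

lemma norm_G_le:
  assumes s: "Re s \<le> 1" and x: "x > 0"
  shows "norm (G s x) \<le> exp (- (x / 2)) * (2 / x)"
proof -
  have "norm (G_moment 0 s x) \<le> exp (- (x / 2)) * (fact 0 / (x / 2) ^ Suc 0)"
    unfolding G_moment_def
  proof (rule mellin_bound_power_exp(2)[OF s])
    fix y :: real assume y: "y \<ge> 1"
    have "x * 1 \<le> x * y" using x y by (intro mult_left_mono) auto
    thus "\<bar>(- y) ^ 0 * exp (- x * y)\<bar> \<le> exp (- (x / 2)) * (y ^ 0 * exp (- (x / 2) * y))"
      by (simp add: exp_add[symmetric])
  qed (use x in \<open>auto intro!: continuous_intros\<close>)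
  thus ?thesis by (simp add: G_moment_0)
qed

text \<open>The Lagrange remainder is evaluated at some t < 0, where exp t <= 1, so no factor
  growing with u appears. The cases u = 0 and n = 0 have no such interior point and are checked
  directly.\<close>

lemma exp_minus_taylor_remainder:
  fixes u :: real
  assumes "u \<ge> 0"
  shows "\<bar>exp (- u) - (\<Sum>k<n. (- u) ^ k / fact k)\<bar> \<le> u ^ n / fact n"
proof (cases "u = 0 \<or> n = 0")
  case True
  thus ?thesis using assms by (cases n) (auto simp: lessThan_Suc_eq_insert_0 sum.reindex)
next
  case False
  then obtain t where t: "t < 0"
    "exp (- u) = (\<Sum>m<n. exp 0 / fact m * (- u) ^ m) + exp t / fact n * (- u) ^ n"
    using Maclaurin_minus[of "- u" n "\<lambda>_. exp" exp] assms by auto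
  have "\<bar>exp (- u) - (\<Sum>k<n. (- u) ^ k / fact k)\<bar> = exp t * (u ^ n / fact n)"
    unfolding t(2) using assms by (simp add: abs_mult power_abs)
  also have "\<dots> \<le> 1 * (u ^ n / fact n)" using t(1) assms by (intro mult_right_mono) auto
  finally show ?thesis by simp
qed

lemma G_taylor_remainder:
  assumes s: "Re s \<le> 1" and x: "x > 0" and h: "h \<ge> 0"
  shows "norm (G s (x + h) - (\<Sum>k\<le>B. dG k s x * of_real (h ^ k / fact k))) \<le> (h / x) ^ Suc B / x"
proof -
  define r where "r = (\<lambda>y. exp (- x * y) * (exp (- (h * y)) - (\<Sum>k<Suc B. (- (h * y)) ^ k / fact k)))"
  have xh: "x + h > 0" using x h by simp
  have int: "set_integrable lborel {1..}
      (\<lambda>y. of_real (h ^ k / fact k) * (of_real ((- y) ^ k * exp (- x * y)) * mellin_kernel s y))" for k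
    using G_moment_integrable[OF s x, of k] by (intro set_integrable_mult_right) blast
  have sum: "(\<Sum>k\<le>B. dG k s x * of_real (h ^ k / fact k)) =
      (LBINT y:{1..}. \<Sum>k\<le>B. of_real (h ^ k / fact k) * (of_real ((- y) ^ k * exp (- x * y)) * mellin_kernel s y))"
    and sumi: "set_integrable lborel {1..} (\<lambda>y. \<Sum>k\<le>B. of_real (h ^ k / fact k) * (of_real ((- y) ^ k * exp (- x * y)) * mellin_kernel s y))"
  proof -
    have "dG k s x * of_real (h ^ k / fact k) =
        (LBINT y:{1..}. of_real (h ^ k / fact k) * (of_real ((- y) ^ k * exp (- x * y)) * mellin_kernel s y))" for k
      by (simp only: dG_eq_G_moment[OF s x] G_moment_def set_integral_mult_right mult.commute)
    thus "(\<Sum>k\<le>B. dG k s x * of_real (h ^ k / fact k)) =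
      (LBINT y:{1..}. \<Sum>k\<le>B. of_real (h ^ k / fact k) * (of_real ((- y) ^ k * exp (- x * y)) * mellin_kernel s y))"
      using int unfolding set_lebesgue_integral_def set_integrable_def scaleR_sum_right
      by (simp only: Bochner_Integration.integral_sum)
    show "set_integrable lborel {1..} (\<lambda>y. \<Sum>k\<le>B. of_real (h ^ k / fact k) * (of_real ((- y) ^ k * exp (- x * y)) * mellin_kernel s y))"
      using int unfolding set_integrable_def scaleR_sum_right
      by (rule Bochner_Integration.integrable_sum)
  qed
  have "G s (x + h) - (\<Sum>k\<le>B. dG k s x * of_real (h ^ k / fact k)) =
      (LBINT y:{1..}. of_real ((- y) ^ 0 * exp (- (x + h) * y)) * mellin_kernel s y
        - (\<Sum>k\<le>B. of_real (h ^ k / fact k) * (of_real ((- y) ^ k * exp (- x * y)) * mellin_kernel s y)))"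
    unfolding sum set_integral_diff(2)[OF G_moment_integrable[OF s xh] sumi]
    by (simp only: G_moment_0[symmetric] G_moment_def)
  also have "\<dots> = (LBINT y:{1..}. of_real (r y) * mellin_kernel s y)"
  proof (rule arg_cong[where f = "\<lambda>f. LBINT y:{1..}. f y"], rule ext)
    fix y
    have "r y = (- y) ^ 0 * exp (- (x + h) * y) - (\<Sum>k\<le>B. h ^ k / fact k * ((- y) ^ k * exp (- x * y)))"
    proof -
      have "exp (- (x + h) * y) = exp (- x * y) * exp (- (h * y))"
        unfolding exp_add[symmetric] by (rule arg_cong[where f = exp]) (simp add: algebra_simps)
      moreover have "exp (- x * y) * ((- (h * y)) ^ k / fact k) = h ^ k / fact k * ((- y) ^ k * exp (- x * y))" for k
      proof -
        have "- (h * y) = h * (- y)" by simp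
        thus ?thesis by (simp only: power_mult_distrib) simp
      qed
      ultimately show ?thesis
        by (simp only: r_def lessThan_Suc_atMost right_diff_distrib sum_distrib_left power_0 mult_1)
    qed
    thus "of_real ((- y) ^ 0 * exp (- (x + h) * y)) * mellin_kernel s y
        - (\<Sum>k\<le>B. of_real (h ^ k / fact k) * (of_real ((- y) ^ k * exp (- x * y)) * mellin_kernel s y))
        = of_real (r y) * mellin_kernel s y"
      by (simp add: left_diff_distrib sum_distrib_right mult.assoc)
  qed
  \<comment> \<open>The moment of y^(B+1) produces (B+1)!, which cancels the factorial of the
    remainder and leaves a purely geometric rate in h/x.\<close>
  also have "norm \<dots> \<le> h ^ Suc B / fact (Suc B) * (fact (Suc B) / x ^ Suc (Suc B))"
  proof (rule mellin_bound_power_exp(2)[OF s x])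
    show "continuous_on {1..} r" unfolding r_def by (intro continuous_intros) auto
    fix y :: real assume y: "y \<ge> 1"
    have "\<bar>r y\<bar> \<le> exp (- x * y) * ((h * y) ^ Suc B / fact (Suc B))"
      unfolding r_def abs_mult
      using exp_minus_taylor_remainder[of "h * y" "Suc B"] h y by (intro mult_mono) auto
    thus "\<bar>r y\<bar> \<le> h ^ Suc B / fact (Suc B) * (y ^ Suc B * exp (- x * y))"
      by (simp add: power_mult_distrib mult_ac)
  qed
  also have "\<dots> = (h / x) ^ Suc B / x" by (simp add: power_divide)
  finally show ?thesis .
qed


section \<open>Size of the terms of Z, absolute convergence and the tail\<close>

lemma dirichlet_character_norm_le_1:
  assumes chi: "dirichlet_character d chi"
  shows "norm (chi (int n)) \<le> 1"
proof (rule ccontr)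
  assume gt: "\<not> ?thesis"
  have d: "d > 0" and mult: "chi (m * n) = chi m * chi n" and per: "chi (n + int d) = chi n"
    and unit: "chi n \<noteq> 0 \<longleftrightarrow> coprime n (int d)" for m n
    using chi by (auto simp: dirichlet_character_def)
  have period: "chi (int (m + k * d)) = chi (int m)" for m k
  proof (induction k)
    case (Suc k)
    have "chi (int (m + Suc k * d)) = chi (int (m + k * d) + int d)"
      by (simp add: algebra_simps)
    thus ?case using per Suc by simp
  qed simp
  \<comment> \<open>Periodicity bounds chi on the naturals by \<open>K\<close>, while
    multiplicativity would make chi unbounded on the powers of an n with |chi n| > 1.\<close>
  define K where "K = Max ((\<lambda>m. norm (chi (int m))) ` {..<d})"
  have K: "norm (chi (int m)) \<le> K" for m
  proof -
    have "norm (chi (int m)) = norm (chi (int (m mod d)))"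
      using period[of "m mod d" "m div d"] by simp
    also have "\<dots> \<le> K" unfolding K_def using d by (intro Max_ge) auto
    finally show ?thesis .
  qed
  have chi1: "chi 1 = 1" using mult[of 1 1] unit[of 1] by simp
  have pow: "chi (int (n ^ k)) = chi (int n) ^ k" for k
    by (induction k) (simp_all add: chi1 mult)
  obtain k where "K < norm (chi (int n)) ^ k"
    using real_arch_pow[of "norm (chi (int n))" K] gt by auto
  with K[of "n ^ k"] show False by (simp only: pow norm_power)
qed

text \<open>Follows from chi(-1)^2 = chi(1) = 1. It makes the complex power n^a equal to 1 or n, and
  Re s equal to 1/4 or 3/4.\<close>

lemma char_parity_cases:
  assumes chi: "dirichlet_character d chi"
  shows "char_parity chi = 0 \<or> char_parity chi = 1"
proof -
  have mult: "chi (m * n) = chi m * chi n" and unit: "chi n \<noteq> 0 \<longleftrightarrow> coprime n (int d)" for m n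
    using chi by (auto simp: dirichlet_character_def)
  have "chi 1 = 1" using mult[of 1 1] unit[of 1] by simp
  hence "(chi (- 1))\<^sup>2 = 1" using mult[of "- 1" "- 1"] by (simp add: power2_eq_square)
  hence "chi (- 1) = 1 \<or> chi (- 1) = - 1" by (simp add: power2_eq_1_iff)
  thus ?thesis by (auto simp: char_parity_def)
qed

lemma norm_coeff_le:
  assumes chi: "dirichlet_character d chi" and n: "n \<ge> 1"
  shows "norm (chi (int n) * of_nat n powr char_parity chi) \<le> real n"
proof -
  have "norm (of_nat n powr char_parity chi) \<le> real n"
    using char_parity_cases[OF chi] n by auto
  thus ?thesis
    using mult_mono[OF dirichlet_character_norm_le_1[OF chi, of n]] by (force simp: norm_mult)
qed

lemma Re_s_param_le:
  assumes "dirichlet_character d chi"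
  shows "Re (s_param chi t) \<le> 1"
  using char_parity_cases[OF assms] by (auto simp: s_param_def)

text \<open>The coefficient contributes at most n, and \<open>norm_G_le\<close> is applied at x = pi
  n^2/d, where pi >= 2 gives x/2 >= n^2/d.\<close>

lemma Z_term_le:
  assumes chi: "dirichlet_character d chi" and n: "n \<ge> 1"
  shows "norm (chi (int n) * of_nat n powr char_parity chi *
           of_real (2 * Re (G (s_param chi t) (pi * real (n ^ 2) / real d))))
         \<le> 2 * real d / real n * exp (- (real (n ^ 2) / real d))"
proof -
  have d: "d > 0" using chi by (simp add: dirichlet_character_def)
  define x where "x = pi * real (n ^ 2) / real d"
  have x: "x > 0" using d n by (simp add: x_def)
  have x2: "real (n ^ 2) / real d \<le> x / 2"
    using d pi_ge_two n by (simp add: x_def field_simps)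
  have q: "real (n ^ 2) / real d > 0" using d n by simp
  have "2 / x = 1 / (x / 2)" by simp
  also have "\<dots> \<le> 1 / (real (n ^ 2) / real d)" using x2 q x by (intro divide_left_mono mult_pos_pos) linarith+
  finally have inv: "2 / x \<le> real d / real (n ^ 2)" by simp
  have "\<bar>Re (G (s_param chi t) x)\<bar> \<le> exp (- (x / 2)) * (2 / x)"
    using norm_G_le[OF Re_s_param_le[OF chi] x] abs_Re_le_cmod order_trans by blast
  also have "\<dots> \<le> exp (- (real (n ^ 2) / real d)) * (real d / real (n ^ 2))"
    using x2 inv x by (intro mult_mono) auto
  finally have "\<bar>2 * Re (G (s_param chi t) x)\<bar> \<le> 2 * (exp (- (real (n ^ 2) / real d)) * (real d / real (n ^ 2)))"
    by (simp add: abs_mult)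
  hence "norm (chi (int n) * of_nat n powr char_parity chi * of_real (2 * Re (G (s_param chi t) x)))
      \<le> real n * (2 * (exp (- (real (n ^ 2) / real d)) * (real d / real (n ^ 2))))"
    unfolding norm_mult[of _ "of_real _"] norm_of_real
    by (intro mult_mono norm_coeff_le[OF chi n]) auto
  also have "\<dots> = 2 * real d / real n * exp (- (real (n ^ 2) / real d))"
    using n by (simp add: power2_eq_square field_simps)
  finally show ?thesis by (simp only: x_def)
qed

text \<open>As n^2 >= n, a geometric series of ratio exp (-1/d) dominates. An \<open>infsum\<close>
  defaults to 0 without summability, so this is what allows Z to be split into head and
  tail.\<close>

lemma Z_abs_summable:
  assumes chi: "dirichlet_character d chi"
  shows "(\<lambda>n. norm (chi (int n) * of_nat n powr char_parity chi *
           of_real (2 * Re (G (s_param chi t) (pi * real (n ^ 2) / real d))))) summable_on {1..}"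
proof (rule Infinite_Sum.abs_summable_on_comparison_test')
  have d: "d > 0" using chi by (simp add: dirichlet_character_def)
  have "norm (exp (- 1 / real d)) < 1" using d by simp
  from has_sum_geometric_from_1[OF this]
  show "(\<lambda>n. 2 * real d * exp (- 1 / real d) ^ n) summable_on {1..}"
    by (intro summable_on_cmult_right) (rule has_sum_imp_summable)
  fix n :: nat assume "n \<in> {1..}"
  hence n: "n \<ge> 1" by simp
  have "real n \<le> real (n ^ 2)" using n by (simp add: power2_eq_square)
  hence "exp (- (real (n ^ 2) / real d)) \<le> exp (real n * (- 1 / real d))"
    using d by (simp add: divide_right_mono)
  moreover have "2 * real d / real n \<le> 2 * real d / 1"
    using n by (intro divide_left_mono) auto
  ultimately have "2 * real d / real n * exp (- (real (n ^ 2) / real d))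
      \<le> 2 * real d * exp (real n * (- 1 / real d))"
    by (intro mult_mono) auto
  thus "norm (chi (int n) * of_nat n powr char_parity chi *
           of_real (2 * Re (G (s_param chi t) (pi * real (n ^ 2) / real d))))
        \<le> 2 * real d * exp (- 1 / real d) ^ n"
    using Z_term_le[OF chi n, of t] by (simp only: exp_of_nat_mult)
qed

text \<open>For n >= d one has n^2/d >= n, so a term is at most 2 exp (-n) <= 2 exp (-d/2) exp
  (-n/2): a factor decaying in d times a geometric series. \<open>A\<close> is arbitrary because the
  neglected n need not start exactly at d.\<close>

lemma Z_tail_le:
  assumes chi: "dirichlet_character d chi" and A: "A \<subseteq> {d..}"
  shows "norm (\<Sum>\<^sub>\<infinity>n\<in>A. chi (int n) * of_nat n powr char_parity chi *
           of_real (2 * Re (G (s_param chi t) (pi * real (n ^ 2) / real d)))) \<le> 8 / real d"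
    (is "norm (infsum ?f A) \<le> _")
proof -
  have d: "d > 0" using chi by (simp add: dirichlet_character_def)
  have A1: "A \<subseteq> {1..}" using A d by force
  define z where "z = exp (- (1 / 2) :: real)"
  have half: "1 + 1 / 2 \<le> exp (1 / 2 :: real)" by (rule exp_ge_add_one_self)
  have z: "z < 1" "z > 0" by (auto simp: z_def)
  have "z * exp (1 / 2) = 1" by (simp add: z_def exp_minus)
  \<comment> \<open>That is z <= 2/3, which bounds the geometric sum z/(1 - z) by 2.\<close>
  hence "z * (1 + 1 / 2) \<le> 1" using mult_left_mono[OF half, of z] z by simp
  hence z2: "z / (1 - z) \<le> 2" using z by (simp add: field_simps)
  define g where "g = (\<lambda>n. 2 * exp (- real d / 2) * z ^ n)"
  have g: "(g has_sum (2 * exp (- real d / 2) * (z / (1 - z)))) {1..}"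
    unfolding g_def using z by (intro has_sum_cmult_right has_sum_geometric_from_1) auto
  have abs: "(\<lambda>n. norm (?f n)) summable_on A"
    using summable_on_subset[OF Z_abs_summable[OF chi] A1] .
  have le: "norm (?f n) \<le> g n" if "n \<in> A" for n
  proof -
    have n: "n \<ge> 1" "n \<ge> d" using that A A1 by auto
    have "real d * real n \<le> real n * real n" using n by (intro mult_right_mono) auto
    hence "real n \<le> real (n ^ 2) / real d" using d by (simp add: field_simps power2_eq_square)
    moreover have "2 * real d / real n \<le> 2" using n by (simp add: field_simps)
    ultimately have "2 * real d / real n * exp (- (real (n ^ 2) / real d)) \<le> 2 * exp (- real n)"
      by (intro mult_mono) auto
    also have "\<dots> \<le> 2 * exp (- real d / 2 + real n * (- (1 / 2)))" using n by simp
    also have "\<dots> = g n" by (simp only: g_def z_def exp_add exp_of_nat_mult mult.assoc)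
    finally show ?thesis using Z_term_le[OF chi n(1), of t] by linarith
  qed
  have "norm (infsum ?f A) \<le> infsum (\<lambda>n. norm (?f n)) A"
    using abs by (rule norm_infsum_bound)
  also have "\<dots> \<le> infsum g A"
    using abs summable_on_subset[OF has_sum_imp_summable[OF g] A1] le by (rule infsum_mono)
  also have "\<dots> \<le> infsum g {1..}"
    using summable_on_subset[OF has_sum_imp_summable[OF g] A1] has_sum_imp_summable[OF g] A1 z
    by (intro infsum_mono2) (auto simp: g_def)
  also have "\<dots> = 2 * exp (- real d / 2) * (z / (1 - z))" using g by (rule infsumI)
  also have "\<dots> \<le> 2 * exp (- real d / 2) * 2" using z2 by (intro mult_left_mono) auto
  also have "\<dots> = 4 / exp (real d / 2)"
    using exp_minus_inverse[of "real d / 2"] by (simp add: field_simps)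
  also have "\<dots> \<le> 4 / (real d / 2)"
  proof (rule divide_left_mono)
    show "real d / 2 \<le> exp (real d / 2)" using exp_ge_add_one_self[of "real d / 2"] by linarith
  qed (use d in auto)
  finally show ?thesis by simp
qed


section \<open>Fibonacci growth and the blocks I_j\<close>

lemma fib_Suc_le_double: "n \<ge> 1 \<Longrightarrow> fib (Suc n) \<le> 2 * fib n"
proof -
  assume "n \<ge> 1"
  then obtain m where m: "n = Suc m" by (cases n) auto
  show ?thesis using fib_Suc_mono[of m] by (simp add: m)
qed

lemma fib_le_power_2: "fib n \<le> 2 ^ n"
proof (induction n)
  case (Suc n)
  show ?case
  proof (cases "n = 0")
    case False
    thus ?thesis using fib_Suc_le_double[of n] Suc by simp
  qed simp
qed simp

lemma power_2_le_fib: "2 ^ n \<le> fib (2 * n + 1)"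
proof (induction n)
  case (Suc n)
  have "fib (2 * Suc n + 1) = fib (2 * n + 2) + fib (2 * n + 1)" by simp
  moreover have "fib (2 * n + 1) \<le> fib (2 * n + 2)" by (intro fib_mono) simp
  ultimately show ?case using Suc by simp
qed simp

text \<open>The gap is below F_{j-1}, and F_{j-1} <= 2 F_{j-2} gives F_j >= (3/2) F_{j-1}. A ratio
  strictly below 1 is what makes the Taylor error geometric.\<close>

lemma fib_gap_ratio:
  assumes "j \<ge> 1" "m \<in> {fib j..<fib (j + 1)}"
  shows "3 * (real m - real (fib j)) \<le> 2 * real (fib j)"
proof -
  obtain i where i: "j = Suc i" using assms by (cases j) auto
  have m: "fib j \<le> m" "m < fib j + fib i" using assms by (auto simp: i)
  \<comment> \<open>Here I_1 = [1,1) is empty and I_2 = [1,2) has gap 0; the recurrence argument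
    covers the remaining blocks.\<close>
  consider "i = 0" | "i = 1" | k where "i = Suc k" "k \<ge> 1"
    by (cases i) (auto simp: Suc_le_eq)
  hence "3 * (m - fib j) \<le> 2 * fib j"
  proof cases
    case 3
    have "fib i \<le> 2 * fib k" using fib_Suc_le_double[of k] 3 by simp
    moreover have "fib j = fib i + fib k" using i 3 by simp
    ultimately show ?thesis using m by linarith
  qed (use m i in auto)
  hence "real (3 * (m - fib j)) \<le> real (2 * fib j)" by (simp only: of_nat_le_iff)
  thus ?thesis using m by (simp add: of_nat_diff)
qed

lemma squares_below_subset: "{n::nat. 1 \<le> n \<and> n ^ 2 < N} \<subseteq> {1..N}"
proof safe
  fix n :: nat assume "1 \<le> n" "n ^ 2 < N"
  moreover have "n * 1 \<le> n * n" using \<open>1 \<le> n\<close> by (intro mult_left_mono) auto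
  ultimately have "n \<le> N" by (simp only: power2_eq_square)
  thus "n \<in> {1..N}" using \<open>1 \<le> n\<close> by simp
qed

lemma finite_squares_below: "finite {n::nat. 1 \<le> n \<and> n ^ 2 < N}"
  using squares_below_subset by (rule finite_subset) simp

text \<open>The blocks I_1, ..., I_T tile [1, F_{T+1}); since F_1 = F_2, the block I_1 is empty and
  nothing is counted twice.\<close>

lemma sum_squares_below_fib:
  "(\<Sum>n | 1 \<le> n \<and> n ^ 2 < fib (Suc T). f n) =
     (\<Sum>j=1..T. \<Sum>n | 1 \<le> n \<and> n ^ 2 \<in> {fib j..<fib (j + 1)}. f n)"
proof (induction T)
  case 0
  have "{n::nat. 1 \<le> n \<and> n ^ 2 < fib (Suc 0)} = {}" by auto
  thus ?case by (simp only: sum.empty) simp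
next
  case (Suc T)
  have "{n. 1 \<le> n \<and> n ^ 2 < fib (Suc (Suc T))} =
      {n. 1 \<le> n \<and> n ^ 2 < fib (Suc T)} \<union> {n. 1 \<le> n \<and> n ^ 2 \<in> {fib (Suc T)..<fib (Suc T + 1)}}"
    using fib_Suc_mono[of "Suc T"] by (auto simp del: fib.simps)
  moreover have "finite {n. 1 \<le> n \<and> n ^ 2 \<in> {fib (Suc T)..<fib (Suc T + 1)}}"
    by (rule finite_subset[OF _ finite_squares_below[of "fib (Suc T + 1)"]]) auto
  ultimately have "(\<Sum>n | 1 \<le> n \<and> n ^ 2 < fib (Suc (Suc T)). f n) =
      (\<Sum>n | 1 \<le> n \<and> n ^ 2 < fib (Suc T). f n) +
      (\<Sum>n | 1 \<le> n \<and> n ^ 2 \<in> {fib (Suc T)..<fib (Suc T + 1)}. f n)"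
    by (simp only:, intro sum.union_disjoint finite_squares_below) auto
  thus ?case by (simp only: Suc.IH) simp
qed

section \<open>Taylor error on the blocks and the choice of T and B\<close>

lemma Z_term_taylor_error:
  assumes chi: "dirichlet_character d chi" and n: "n \<ge> 1" and j: "j \<ge> 1"
    and I: "n ^ 2 \<in> {fib j..<fib (j + 1)}"
  shows "norm (chi (int n) * of_nat n powr char_parity chi *
             of_real (2 * Re (G (s_param chi t) (pi * real (n ^ 2) / real d))) -
           (\<Sum>k=0..B. of_real (G_coeff d chi j k t * (pi / real d) ^ k) *
             (chi (int n) * of_nat n powr char_parity chi * (of_nat (n ^ 2) - of_nat (fib j)) ^ k)))
         \<le> 2 * real n * real d * (2 / 3) ^ Suc B"
proof -
  have d: "d > 0" using chi by (simp add: dirichlet_character_def)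
  define c where "c = chi (int n) * of_nat n powr char_parity chi"
  define s where "s = s_param chi t"
  define x where "x = pi * real (fib j) / real d"
  define h where "h = pi / real d * (real (n ^ 2) - real (fib j))"
  have Fj: "fib j \<ge> 1" using fib_neq_0_nat[of j] j by simp
  have x: "x > 0" using d Fj by (simp add: x_def)
  have "real (fib j) \<le> real (n ^ 2)" using I by (simp only: of_nat_le_iff) simp
  hence h: "h \<ge> 0" by (simp add: h_def)
  have "h / x = (real (n ^ 2) - real (fib j)) / real (fib j)"
    using d by (simp add: h_def x_def)
  also have "\<dots> \<le> 2 / 3" using fib_gap_ratio[OF j I] Fj by (simp add: field_simps)
  finally have hx: "h / x \<le> 2 / 3" .
  have xh: "x + h = pi * real (n ^ 2) / real d" using d by (simp add: x_def h_def field_simps)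
  \<comment> \<open>The factor 1/x of the Taylor remainder is largest for F_j = 1; it costs at most
    d.\<close>
  have "1 / real d \<le> x"
    unfolding x_def using d Fj pi_ge_two mult_mono[of 1 pi 1 "real (fib j)"]
    by (intro divide_right_mono) auto
  hence ix: "1 / x \<le> real d" using d x by (simp add: field_simps)
  define E where "E = G s (x + h) - (\<Sum>k\<le>B. dG k s x * of_real (h ^ k / fact k))"
  have "norm E \<le> (h / x) ^ Suc B * (1 / x)"
    using G_taylor_remainder[OF Re_s_param_le[OF chi] x h] by (simp add: E_def s_def)
  also have "\<dots> \<le> (2 / 3) ^ Suc B * real d"
    using hx ix h x by (intro mult_mono power_mono) auto
  finally have E: "norm E \<le> (2 / 3) ^ Suc B * real d" .
  have ReE: "Re E = Re (G s (x + h)) - (\<Sum>k\<le>B. Re (dG k s x) * (h ^ k / fact k))"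
    by (simp only: E_def minus_complex.simps Re_sum times_complex.simps Re_complex_of_real Im_complex_of_real) simp
  \<comment> \<open>Since h = (pi/d)(n^2 - F_j), the powers in S combine to h^k; this is real, so
    taking real parts commutes with the Taylor sum.\<close>
  have "of_real (G_coeff d chi j k t * (pi / real d) ^ k) * (c * (of_nat (n ^ 2) - of_nat (fib j)) ^ k)
      = c * of_real (2 * (Re (dG k s x) * (h ^ k / fact k)))" for k
  proof -
    have "of_nat (n ^ 2) - of_nat (fib j) = complex_of_real (real (n ^ 2) - real (fib j))"
      by simp
    moreover have "G_coeff d chi j k t * (pi / real d) ^ k * (real (n ^ 2) - real (fib j)) ^ k
        = 2 * (Re (dG k s x) * (h ^ k / fact k))"
      unfolding G_coeff_def h_def power_mult_distrib by (simp add: s_def x_def)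
    ultimately show ?thesis by (metis (no_types, lifting) of_real_mult of_real_power mult.assoc mult.left_commute)
  qed
  hence "c * of_real (2 * Re (G s (x + h))) - (\<Sum>k=0..B. of_real (G_coeff d chi j k t * (pi / real d) ^ k) *
        (c * (of_nat (n ^ 2) - of_nat (fib j)) ^ k)) = c * of_real (2 * Re E)"
    by (simp only: ReE atLeast0AtMost sum_distrib_left[symmetric] of_real_sum[symmetric] right_diff_distrib of_real_diff)
  also have "norm \<dots> \<le> real n * (2 * ((2 / 3) ^ Suc B * real d))"
    unfolding norm_mult[of c] norm_of_real
    using order_trans[OF abs_Re_le_cmod E] norm_coeff_le[OF chi n]
    by (intro mult_mono) (auto simp: c_def abs_mult simp del: power_Suc)
  finally show ?thesis
    unfolding c_def s_def xh by (simp only: mult_ac)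
qed

text \<open>The condition on T forces every n left out of S to be at least d, where the tail bound
  applies. The square of F_{T+1} arises from at most F_{T+1} terms, each with n <= F_{T+1}.\<close>

lemma Z_minus_S_le:
  assumes chi: "dirichlet_character d chi" and T: "fib (Suc T) \<ge> d ^ 2"
  shows "norm (Z d chi t - S T B d chi t)
         \<le> 8 / real d + 2 * real (fib (Suc T)) ^ 2 * real d * (2 / 3) ^ Suc B"
proof -
  define N where "N = fib (Suc T)"
  define f where "f = (\<lambda>n. chi (int n) * of_nat n powr char_parity chi *
      complex_of_real (2 * Re (G (s_param chi t) (pi * real (n ^ 2) / real d))))"
  define g where "g = (\<lambda>j n. \<Sum>k=0..B. of_real (G_coeff d chi j k t * (pi / real d) ^ k) *
      (chi (int n) * of_nat n powr char_parity chi * (of_nat (n ^ 2) - of_nat (fib j)) ^ k))"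
  define A where "A = (\<lambda>j. {n. 1 \<le> n \<and> n ^ 2 \<in> {fib j..<fib (j + 1)}})"
  define P where "P = {n. 1 \<le> n \<and> n ^ 2 < N}"
  have fin: "finite P" unfolding P_def by (rule finite_squares_below)
  have PN: "P \<subseteq> {1..N}" unfolding P_def by (rule squares_below_subset)
  \<comment> \<open>Kept generic in the target type: it serves both the complex main terms and the
    real error bounds.\<close>
  have sumP: "(\<Sum>n\<in>P. h n) = (\<Sum>j=1..T. \<Sum>n\<in>A j. h n)" for h :: "nat \<Rightarrow> 'b::comm_monoid_add"
    unfolding P_def N_def A_def by (rule sum_squares_below_fib)
  have summ: "f summable_on {1..}"
    using Z_abs_summable[OF chi, of t] unfolding f_def by (rule abs_summable_summable)
  have "{1..} = P \<union> ({1..} - P)" using PN by auto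
  hence "Z d chi t = infsum f (P \<union> ({1..} - P))" unfolding Z_def f_def by simp
  also have "\<dots> = infsum f P + infsum f ({1..} - P)"
    using fin by (intro infsum_Un_disjoint summable_on_subset[OF summ]) (use PN in auto)
  also have "infsum f P = (\<Sum>j=1..T. \<Sum>n\<in>A j. f n)" using fin by (simp add: sumP)
  finally have Z: "Z d chi t = (\<Sum>j=1..T. \<Sum>n\<in>A j. f n) + infsum f ({1..} - P)" .
  have S: "S T B d chi t = (\<Sum>j=1..T. \<Sum>n\<in>A j. g j n)"
    unfolding S_def g_def A_def sum_distrib_left by (rule sum.cong[OF refl], rule sum.swap)
  have tail: "norm (infsum f ({1..} - P)) \<le> 8 / real d"
    unfolding f_def
  proof (rule Z_tail_le[OF chi], safe)
    fix n assume "1 \<le> n" "n \<notin> P"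
    hence "d ^ 2 \<le> n ^ 2" using T unfolding P_def N_def mem_Collect_eq by linarith
    thus "d \<le> n" by (simp add: power2_nat_le_eq_le)
  qed
  have "norm ((\<Sum>j=1..T. \<Sum>n\<in>A j. f n) - (\<Sum>j=1..T. \<Sum>n\<in>A j. g j n))
      = norm (\<Sum>j=1..T. \<Sum>n\<in>A j. f n - g j n)"
    by (simp only: sum_subtractf)
  also have "\<dots> \<le> (\<Sum>j=1..T. \<Sum>n\<in>A j. 2 * real n * real d * (2 / 3) ^ Suc B)"
    unfolding f_def g_def
    by (intro order_trans[OF norm_sum] sum_mono Z_term_taylor_error[OF chi]) (auto simp: A_def)
  also have "\<dots> = (\<Sum>n\<in>P. 2 * real n * real d * (2 / 3) ^ Suc B)" by (rule sumP[symmetric])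
  also have "\<dots> \<le> (\<Sum>n\<in>P. 2 * real N * real d * (2 / 3) ^ Suc B)"
    using PN by (intro sum_mono mult_right_mono mult_left_mono) auto
  also have "\<dots> = real (card P) * (2 * real N * real d * (2 / 3) ^ Suc B)" by simp
  also have "\<dots> \<le> real N * (2 * real N * real d * (2 / 3) ^ Suc B)"
    using card_mono[OF _ PN] by (intro mult_right_mono) auto
  finally have main: "norm ((\<Sum>j=1..T. \<Sum>n\<in>A j. f n) - (\<Sum>j=1..T. \<Sum>n\<in>A j. g j n))
      \<le> 2 * real N ^ 2 * real d * (2 / 3) ^ Suc B"
    by (simp add: power2_eq_square mult_ac)
  have "Z d chi t - S T B d chi t = ((\<Sum>j=1..T. \<Sum>n\<in>A j. f n) - (\<Sum>j=1..T. \<Sum>n\<in>A j. g j n))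
      + infsum f ({1..} - P)"
    unfolding Z S by simp
  thus ?thesis
    using norm_triangle_ineq[of "(\<Sum>j=1..T. \<Sum>n\<in>A j. f n) - (\<Sum>j=1..T. \<Sum>n\<in>A j. g j n)" "infsum f ({1..} - P)"]
      main tail by (simp only: N_def)
qed

text \<open>With d <= 3^L, the index 8L gives F_{8L+1} >= 16^L >= d^2 and F_{8L+1}^2 <= 4 (256^2)^L.
  The factor 40 is chosen so that 256^2 (2/3)^40 <= 1/9, making the Taylor error at most 8d/9^L <=
  8/d, the size of the tail bound.\<close>

lemma truncation_error_le:
  assumes chi: "dirichlet_character d chi" and L: "ln (real d) \<le> real L"
  shows "norm (Z d chi t - S (8 * L) (40 * L) d chi t) \<le> 16 / real d"
proof -
  have d: "d > 0" using chi by (simp add: dirichlet_character_def)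
  have "real d = exp (ln (real d))" using d by simp
  also have "\<dots> \<le> exp (real L * 1)" using L by simp
  also have "\<dots> = exp 1 ^ L" by (rule exp_of_nat_mult)
  also have "\<dots> \<le> 3 ^ L" by (rule power_mono[OF exp_le]) simp
  finally have dL: "real d \<le> 3 ^ L" .
  hence "real d ^ 2 \<le> (3 ^ L) ^ 2" by (intro power_mono) auto
  also have "(3 ^ L) ^ 2 = (9 ^ L :: real)" by (simp add: power2_eq_square flip: power_mult_distrib)
  finally have d9: "real d ^ 2 \<le> 9 ^ L" .
  have "(9::real) ^ L \<le> 16 ^ L" by (intro power_mono) auto
  hence "real (d ^ 2) \<le> real (16 ^ L)" using d9 by simp
  hence "d ^ 2 \<le> 16 ^ L" by (simp only: of_nat_le_iff)
  also have "\<dots> = 2 ^ (4 * L)" by (simp add: power_mult)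
  also have "\<dots> \<le> fib (Suc (8 * L))" using power_2_le_fib[of "4 * L"] by simp
  finally have T: "d ^ 2 \<le> fib (Suc (8 * L))" .
  have "real (fib (Suc (8 * L))) \<le> real (2 ^ Suc (8 * L))"
    using fib_le_power_2 by (simp only: of_nat_le_iff)
  also have "\<dots> = 2 * 256 ^ L" by (simp add: power_mult)
  finally have "real (fib (Suc (8 * L))) ^ 2 \<le> (2 * 256 ^ L) ^ 2" by (intro power_mono) auto
  also have "\<dots> = 4 * (256 ^ 2) ^ L"
    by (simp only: power_mult_distrib flip: power_mult) (simp add: mult.commute)
  finally have F: "real (fib (Suc (8 * L))) ^ 2 \<le> 4 * (256 ^ 2) ^ L" .
  have "(2 / 3 :: real) ^ Suc (40 * L) \<le> ((2 / 3) ^ 40) ^ L"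
    unfolding power_mult[symmetric] by (rule power_decreasing) auto
  hence "2 * real (fib (Suc (8 * L))) ^ 2 * real d * (2 / 3) ^ Suc (40 * L)
      \<le> 2 * (4 * (256 ^ 2) ^ L) * real d * ((2 / 3) ^ 40) ^ L"
    using F by (intro mult_mono) auto
  also have "\<dots> = 8 * real d * (256 ^ 2 * (2 / 3) ^ 40) ^ L"
    by (simp only: power_mult_distrib) simp
  also have "\<dots> \<le> 8 * real d * (1 / 9) ^ L"
    by (intro mult_left_mono power_mono) (auto simp: power_divide field_simps)
  also have "\<dots> = 8 * real d / 9 ^ L" by (simp add: power_divide)
  also have "\<dots> \<le> 8 * real d / real d ^ 2"
    using d9 d by (intro divide_left_mono) auto
  also have "\<dots> = 8 / real d" using d by (simp add: power2_eq_square)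
  finally show ?thesis using Z_minus_S_le[OF chi T, of t "40 * L"] by simp
qed

theorem mainTheorem2:
  fixes D :: nat
  assumes "D \<ge> 1"
  shows "\<exists>C::real. \<forall>\<^sub>F d in sequentially. \<forall>chi.
           primitive_character d chi \<and> real_character chi \<and>
           (\<exists>\<Delta>. of_int \<Delta> = chi (-1) * of_nat d \<and> fundamental_discriminant \<Delta>) \<longrightarrow>
           (\<exists>T B. 0 < T \<and> 0 < B \<and> real T \<le> C * ln (real d) \<and> real B \<le> C * ln (real d) \<and>
              (\<forall>t>0. norm (Z d chi t - S T B d chi t) < 1 / 10 ^ D))"
proof (rule exI, rule eventually_sequentiallyI, intro allI, rule impI)
  \<comment> \<open>The witness C is still schematic here; the final \<open>show\<close> sets it to
    80, as B = 40 L and L <= 2 ln d. Only the threshold depends on D: 16 * 10^D beats the error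
    16/d, and the extra 3 gives d >= e, so that rounding ln d up at most doubles it.\<close>
  fix d :: nat and chi
  assume d: "16 * 10 ^ D + 3 \<le> d"
    and *: "primitive_character d chi \<and> real_character chi \<and>
           (\<exists>\<Delta>. of_int \<Delta> = chi (-1) * of_nat d \<and> fundamental_discriminant \<Delta>)"
  from * have chi: "dirichlet_character d chi" by (simp add: primitive_character_def)
  define L where "L = nat \<lceil>ln (real d)\<rceil>"
  have "exp 1 \<le> real d" using exp_le d by linarith
  hence ln1: "ln (real d) \<ge> 1" using d by (simp add: ln_ge_iff)
  have L: "ln (real d) \<le> real L" "real L \<le> 2 * ln (real d)" "L > 0"
    using ln1 by (auto simp: L_def) linarith+
  have "real (16 * 10 ^ D) < real d" using d by (simp only: of_nat_less_iff)
  hence "16 / real d < 1 / 10 ^ D" using d by (simp add: field_simps)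
  hence "\<forall>t>0. norm (Z d chi t - S (8 * L) (40 * L) d chi t) < 1 / 10 ^ D"
    using truncation_error_le[OF chi L(1)] le_less_trans by blast
  thus "\<exists>T B. 0 < T \<and> 0 < B \<and> real T \<le> 80 * ln (real d) \<and> real B \<le> 80 * ln (real d) \<and>
          (\<forall>t>0. norm (Z d chi t - S T B d chi t) < 1 / 10 ^ D)"
    using L by (intro exI[of _ "8 * L"] exI[of _ "40 * L"]) auto
qed

end
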